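(* Let $\mathcal{A}=\bigcup_\alpha X_\alpha$ be a strong algebra and let $a\in\mathcal{A}$. Then the linear mappings $L_a:\mathcal{A}\to\mathcal{A}$, $x\mapsto ax$, and $R_a:\mathcal{A}\to\mathcal{A}$, $x\mapsto xa$, are continuous. Thus $\mathcal{A}$ is a topological algebra in the sense of Naimark.
   Context: Inductive limit of Banach spaces: a vector space $X$ with a family $\{X_\alpha:\alpha\in A\}$ of subspaces, $X_\alpha\ne X_\beta$ for $\alpha\neq\beta$, directed under inclusion, with $X=\bigcup_\alpha X_\alpha$; the index set $A$ is directed by $\alpha\le\beta$ iff $X_\alpha\subseteq X_\beta$. Each $X_\alpha$ is a Banach space with norm $\|\cdot\|_\alpha$, and whenever $\alpha\le\beta$ the topology induced by $\|\cdot\|_\beta$ on $X_\alpha$ is coarser than that induced by $\|\cdot\|_\alpha$. $X$ carries the inductive limit topology: the finest locally convex topology making all inclusions $X_\alpha\hookrightarrow X$ continuous. Strong algebra: an inductive limit $\mathcal{A}=\bigcup_{\alpha\in A} X_\alpha$ of Banach spaces which is also an (associative) algebra such that for any $\alpha\in A$ there exists $h(\alpha)\in A$ such that for any $\beta\ge h(\alpha)$ there is a positive constant $A_{\beta,\alpha}$ with $\|ab\|_\beta\le A_{\beta,\alpha}\|a\|_\alpha\|b\|_\beta$ and $\|ba\|_\beta\le A_{\beta,\alpha}\|a\|_\alpha\|b\|_\beta$ for every $a\in X_\alpha$, $b\in X_\beta$. Topological algebra in the sense of Naimark: an algebra which is a locally convex topological linear space and in which the product $ab$ is a continuous function of each of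 the factors $a,b$ when the other factor is fixed. *)

theory Defs
  imports "HOL-Analysis.Analysis"
begin

text \<open>
  The scalar field is any type of class \<open>{real_normed_field, banach}\<close>; by the Gelfand--Mazur
  theorem these are exactly the real and the complex numbers.  The ambient vector space is a
  whole type, with an explicit scalar multiplication \<open>smul\<close>.  Since its topology is determined
  by the inductive system, topologies are values of type \<open>'a topology\<close>.
\<close>

definition coarser_topology :: "'a topology \<Rightarrow> 'a topology \<Rightarrow> bool" where
  "coarser_topology S T \<longleftrightarrow> topspace S = topspace T \<and> (\<forall>U. openin S U \<longrightarrow> openin T U)"

definition convex_wrt :: "('k::real_normed_field \<Rightarrow> 'a \<Rightarrow> 'a::ab_group_add) \<Rightarrow> 'a set \<Rightarrow> bool" where
  "convex_wrt smul S \<longleftrightarrow>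
     (\<forall>x\<in>S. \<forall>y\<in>S. \<forall>t::real. 0 \<le> t \<and> t \<le> 1 \<longrightarrow>
        smul (of_real (1 - t)) x + smul (of_real t) y \<in> S)"

text \<open>No separation axiom is required: inductive limits of Banach spaces need not be Hausdorff.\<close>

definition locally_convex_space ::
    "('k::{real_normed_field, banach} \<Rightarrow> 'a \<Rightarrow> 'a::ab_group_add) \<Rightarrow> 'a topology \<Rightarrow> bool" where
  "locally_convex_space smul T \<longleftrightarrow>
     vector_space smul \<and>
     topspace T = UNIV \<and>
     continuous_map (prod_topology T T) T (\<lambda>(x, y). x + y) \<and>
     continuous_map (prod_topology euclidean T) T (\<lambda>(c, x). smul c x) \<and>
     neighbourhood_base_at 0 (convex_wrt smul) T"

definition norm_on ::
    "('k::real_normed_field \<Rightarrow> 'a \<Rightarrow> 'a::ab_group_add) \<Rightarrow> 'a set \<Rightarrow> ('a \<Rightarrow> real) \<Rightarrow> bool" where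
  "norm_on smul S n \<longleftrightarrow>
     (\<forall>x\<in>S. 0 \<le> n x \<and> (n x = 0 \<longleftrightarrow> x = 0)) \<and>
     (\<forall>x\<in>S. \<forall>c. n (smul c x) = norm c * n x) \<and>
     (\<forall>x\<in>S. \<forall>y\<in>S. n (x + y) \<le> n x + n y)"

text \<open>
  The locale \<open>Metric_space\<close> requires symmetry and nonnegativity of the distance on the whole
  type, whereas \<open>n\<close> is meaningful only on \<open>S\<close>; hence the value \<open>0\<close> outside \<open>S\<close>.
\<close>

definition norm_dist :: "'a set \<Rightarrow> ('a \<Rightarrow> real) \<Rightarrow> 'a \<Rightarrow> 'a::ab_group_add \<Rightarrow> real" where
  "norm_dist S n x y = (if x \<in> S \<and> y \<in> S then n (x - y) else 0)"

definition norm_topology :: "'a::ab_group_add set \<Rightarrow> ('a \<Rightarrow> real) \<Rightarrow> 'a topology" where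
  "norm_topology S n = Metric_space.mtopology S (norm_dist S n)"

definition banach_subspace ::
    "('k::{real_normed_field, banach} \<Rightarrow> 'a \<Rightarrow> 'a::ab_group_add) \<Rightarrow> 'a set \<Rightarrow> ('a \<Rightarrow> real) \<Rightarrow> bool" where
  "banach_subspace smul S n \<longleftrightarrow>
     module.subspace smul S \<and> norm_on smul S n \<and> Metric_space.mcomplete S (norm_dist S n)"

text \<open>
  The index order is \<open>i \<le> j \<longleftrightarrow> X i \<subseteq> X j\<close>, written out below.  Nonemptiness of the index set
  follows from \<open>union\<close>.
\<close>

locale banach_inductive_system = vector_space smul
  for smul :: "'k::{real_normed_field, banach} \<Rightarrow> 'a \<Rightarrow> 'a::ab_group_add" +
  fixes I :: "'i set" and X :: "'i \<Rightarrow> 'a set" and nrm :: "'i \<Rightarrow> 'a \<Rightarrow> real"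
  assumes distinct: "inj_on X I"
    and directed: "\<And>i j. i \<in> I \<Longrightarrow> j \<in> I \<Longrightarrow> \<exists>k\<in>I. X i \<subseteq> X k \<and> X j \<subseteq> X k"
    and union: "(\<Union>i\<in>I. X i) = UNIV"
    and banach: "\<And>i. i \<in> I \<Longrightarrow> banach_subspace smul (X i) (nrm i)"
    and coarser: "\<And>i j. i \<in> I \<Longrightarrow> j \<in> I \<Longrightarrow> X i \<subseteq> X j \<Longrightarrow>
      coarser_topology (subtopology (norm_topology (X j) (nrm j)) (X i)) (norm_topology (X i) (nrm i))"

definition admissible_topology ::
    "('k::{real_normed_field, banach} \<Rightarrow> 'a \<Rightarrow> 'a::ab_group_add) \<Rightarrow> 'i set \<Rightarrow> ('i \<Rightarrow> 'a set)
      \<Rightarrow> ('i \<Rightarrow> 'a \<Rightarrow> real) \<Rightarrow> 'a topology \<Rightarrow> bool" where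
  "admissible_topology smul I X nrm T \<longleftrightarrow>
     locally_convex_space smul T \<and>
     (\<forall>i\<in>I. continuous_map (norm_topology (X i) (nrm i)) T (\<lambda>x. x))"

definition inductive_limit_topology ::
    "('k::{real_normed_field, banach} \<Rightarrow> 'a \<Rightarrow> 'a::ab_group_add) \<Rightarrow> 'i set \<Rightarrow> ('i \<Rightarrow> 'a set)
      \<Rightarrow> ('i \<Rightarrow> 'a \<Rightarrow> real) \<Rightarrow> 'a topology" where
  "inductive_limit_topology smul I X nrm =
     (THE T. admissible_topology smul I X nrm T \<and>
        (\<forall>T'. admissible_topology smul I X nrm T' \<longrightarrow> coarser_topology T' T))"

lemma continuous_map_into_sup_topology:
  assumes *: "\<And>T. P T \<Longrightarrow> continuous_map S T f"
  shows "continuous_map S (topology_generated_by (insert UNIV {U. \<exists>T. P T \<and> openin T U})) f"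
proof (rule continuous_on_generated_topo)
  fix U assume "U \<in> insert UNIV {U. \<exists>T. P T \<and> openin T U}"
  then consider "U = UNIV" | T where "P T" "openin T U" by auto
  then show "openin S (f -` U \<inter> topspace S)"
  proof cases
    case 2
    have "openin S {x \<in> topspace S. f x \<in> U}"
      using *[OF 2(1)] 2(2) by (simp add: continuous_map_def)
    moreover have "f -` U \<inter> topspace S = {x \<in> topspace S. f x \<in> U}" by auto
    ultimately show ?thesis by simp
  qed simp
qed simp

text \<open>The finest such topology exists and is unique, so the description above is meaningful.\<close>

lemma inductive_limit_topology_ex1:
  fixes smul :: "'k::{real_normed_field, banach} \<Rightarrow> 'a \<Rightarrow> 'a::ab_group_add"
  assumes vs: "vector_space smul"
  shows "\<exists>!T. admissible_topology smul I X nrm T \<and>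
        (\<forall>T'. admissible_topology smul I X nrm T' \<longrightarrow> coarser_topology T' T)"
proof (rule ex_ex1I)
  define B where "B = insert UNIV {U. \<exists>T. admissible_topology smul I X nrm T \<and> openin T U}"
  define T where "T = topology_generated_by B"
  have top: "topspace T = UNIV"
    by (auto simp: T_def topology_generated_by_topspace B_def)
  have UB: "\<Union>B = UNIV" by (auto simp: B_def)
  have fine: "openin T U" if "admissible_topology smul I X nrm T'" "openin T' U" for T' U
    unfolding T_def by (rule topology_generated_by_Basis) (use that in \<open>auto simp: B_def\<close>)
  have fineid: "continuous_map T T' (\<lambda>x. x)" if "admissible_topology smul I X nrm T'" for T'
    using that fine[OF that] top
    by (auto simp: continuous_map_def admissible_topology_def locally_convex_space_def)
  note contI = continuous_map_into_sup_topology
    [of "admissible_topology smul I X nrm", folded B_def, folded T_def]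
  have add: "continuous_map (prod_topology T T) T (\<lambda>(x, y). x + y)"
  proof (rule contI)
    fix T' assume a: "admissible_topology smul I X nrm T'"
    have "continuous_map (prod_topology T T) (prod_topology T' T') id"
      using continuous_map_prod_top[of T T T' T' "\<lambda>x. x" "\<lambda>x. x"] fineid[OF a] by (simp add: id_def)
    moreover have "continuous_map (prod_topology T' T') T' (\<lambda>(x, y). x + y)"
      using a by (simp add: admissible_topology_def locally_convex_space_def)
    ultimately have "continuous_map (prod_topology T T) T' ((\<lambda>(x, y). x + y) \<circ> id)"
      by (rule continuous_map_compose)
    then show "continuous_map (prod_topology T T) T' (\<lambda>(x, y). x + y)" by simp
  qed
  have mul: "continuous_map (prod_topology euclidean T) T (\<lambda>(c, x). smul c x)"
  proof (rule contI)
    fix T' assume a: "admissible_topology smul I X nrm T'"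
    have "continuous_map (prod_topology (euclidean :: 'k topology) T) (prod_topology euclidean T') id"
      using continuous_map_prod_top[of "euclidean :: 'k topology" T euclidean T' "\<lambda>x. x" "\<lambda>x. x"] fineid[OF a]
      by (simp add: id_def)
    moreover have "continuous_map (prod_topology euclidean T') T' (\<lambda>(c, x). smul c x)"
      using a by (simp add: admissible_topology_def locally_convex_space_def)
    ultimately have "continuous_map (prod_topology euclidean T) T' ((\<lambda>(c, x). smul c x) \<circ> id)"
      by (rule continuous_map_compose)
    then show "continuous_map (prod_topology euclidean T) T' (\<lambda>(c, x). smul c x)" by simp
  qed
  have nb: "neighbourhood_base_at 0 (convex_wrt smul) T"
    unfolding neighbourhood_base_at_def
  proof (intro allI impI)
    fix W assume W: "openin T W \<and> 0 \<in> W"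
    then have "generate_topology_on B W" by (simp add: T_def openin_topology_generated_by)
    then have "0 \<in> W \<Longrightarrow> \<exists>U V. openin T U \<and> convex_wrt smul V \<and> 0 \<in> U \<and> U \<subseteq> V \<and> V \<subseteq> W"
    proof induction
      case (Int a b)
      then obtain U1 V1 U2 V2 where
        "openin T U1" "convex_wrt smul V1" "0 \<in> U1" "U1 \<subseteq> V1" "V1 \<subseteq> a"
        "openin T U2" "convex_wrt smul V2" "0 \<in> U2" "U2 \<subseteq> V2" "V2 \<subseteq> b" by blast
      then show ?case
        by (intro exI[of _ "U1 \<inter> U2"] exI[of _ "V1 \<inter> V2"])
           (auto simp: convex_wrt_def)
    next
      case (UN K)
      then obtain k where "k \<in> K" "0 \<in> k" by blast
      with UN.IH[of k] show ?case by (meson Union_upper order_trans)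
    next
      case (Basis s)
      then consider "s = UNIV" | T' where "admissible_topology smul I X nrm T'" "openin T' s"
        by (auto simp: B_def)
      then show ?case
      proof cases
        case 1
        then show ?thesis
          using openin_topspace[of T] top by (intro exI[of _ UNIV]) (auto simp: convex_wrt_def)
      next
        case 2
        then have "neighbourhood_base_at 0 (convex_wrt smul) T'"
          by (simp add: admissible_topology_def locally_convex_space_def)
        then show ?thesis
          using 2 Basis.prems fine[OF 2(1)] unfolding neighbourhood_base_at_def by meson
      qed
    qed simp
    with W show "\<exists>U V. openin T U \<and> convex_wrt smul V \<and> 0 \<in> U \<and> U \<subseteq> V \<and> V \<subseteq> W" by blast
  qed
  have inc: "continuous_map (norm_topology (X i) (nrm i)) T (\<lambda>x. x)" if "i \<in> I" for i
    by (rule contI) (use that in \<open>auto simp: admissible_topology_def\<close>)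
  have "admissible_topology smul I X nrm T"
    unfolding admissible_topology_def locally_convex_space_def
    using vs top add mul nb inc by blast
  moreover have "coarser_topology T' T" if "admissible_topology smul I X nrm T'" for T'
    using that fine[OF that] top
    by (auto simp: coarser_topology_def admissible_topology_def locally_convex_space_def)
  ultimately show "\<exists>T. admissible_topology smul I X nrm T \<and>
        (\<forall>T'. admissible_topology smul I X nrm T' \<longrightarrow> coarser_topology T' T)" by blast
qed (metis coarser_topology_def topology_eq)

lemmas inductive_limit_topology_finest =
  theI'[OF inductive_limit_topology_ex1, folded inductive_limit_topology_def]

locale associative_algebra = vector_space smul
  for smul :: "'k::field \<Rightarrow> 'a \<Rightarrow> 'a::ring" +
  assumes smul_mult_left: "smul c x * y = smul c (x * y)"
    and smul_mult_right: "x * smul c y = smul c (x * y)"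

text \<open>
  The norm inequalities presuppose that the products lie in \<open>X j\<close>; as \<open>nrm j\<close> is a total
  function with arbitrary values outside \<open>X j\<close>, this is stated explicitly.
\<close>

locale strong_algebra =
  associative_algebra smul + banach_inductive_system smul I X nrm
  for smul :: "'k::{real_normed_field, banach} \<Rightarrow> 'a \<Rightarrow> 'a::ring"
    and I :: "'i set" and X :: "'i \<Rightarrow> 'a set" and nrm :: "'i \<Rightarrow> 'a \<Rightarrow> real" +
  assumes strong: "\<And>i. i \<in> I \<Longrightarrow> \<exists>h\<in>I. \<forall>j\<in>I. X h \<subseteq> X j \<longrightarrow>
      (\<exists>C>0. \<forall>a\<in>X i. \<forall>b\<in>X j.
         a * b \<in> X j \<and> b * a \<in> X j \<and>
         nrm j (a * b) \<le> C * nrm i a * nrm j b \<and> nrm j (b * a) \<le> C * nrm i a * nrm j b)"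

definition naimark_topological_algebra ::
    "('k::{real_normed_field, banach} \<Rightarrow> 'a \<Rightarrow> 'a::ring) \<Rightarrow> 'a topology \<Rightarrow> bool" where
  "naimark_topological_algebra smul T \<longleftrightarrow>
     associative_algebra smul \<and> locally_convex_space smul T \<and>
     (\<forall>a. continuous_map T T (\<lambda>x. a * x)) \<and> (\<forall>b. continuous_map T T (\<lambda>x. x * b))"

end

theory Submission
  imports Defs
begin

text \<open>
  Multiplication by a fixed element is a single linear map, so its continuity is a matter of the
  universal property of the inductive limit topology: a linear map into a locally convex space is
  continuous as soon as its restriction to every \<open>X i\<close> is (\<open>continuous_map_from_inductive_limit\<close>).
  That property is immediate from maximality, because pulling back a locally convex topology along
  a linear map gives a locally convex topology (\<open>locally_convex_space_pullback\<close>); when all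
  restrictions are continuous, the pullback is one of the topologies that the inductive limit
  topology refines.

  The restrictions are handled by a cofinality argument.  The strong inequality for
  \<open>a \<in> X k\<close> bounds multiplication by \<open>a\<close> only on those \<open>X j\<close> that contain \<open>X h\<close>, where \<open>h\<close>
  depends on \<open>k\<close>.  By directedness every \<open>X i\<close> lies in such an \<open>X j\<close>, and the restriction to
  \<open>X i\<close> factors through continuous maps \<open>X i \<rightarrow> X j \<rightarrow> X j \<rightarrow> \<A>\<close>, the middle one being
  multiplication by \<open>a\<close> (\<open>continuous_map_inductive_limit_if_cofinally_bounded\<close>).
\<close>

section \<open>The universal property of the inductive limit topology\<close>

text \<open>
  The vector space operations of the domain become those of the codomain after applying \<open>f\<close>, so
  they are continuous; a basis of convex neighbourhoods is obtained from preimages, which are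
  convex by linearity.
\<close>

lemma locally_convex_space_pullback:
  fixes s1 :: "'k::{real_normed_field, banach} \<Rightarrow> 'a \<Rightarrow> 'a::ab_group_add"
    and s2 :: "'k \<Rightarrow> 'b \<Rightarrow> 'b::ab_group_add"
  assumes f: "Vector_Spaces.linear s1 s2 f" and T: "locally_convex_space s2 T"
  shows "locally_convex_space s1 (pullback_topology UNIV f T)"
proof -
  define P where "P = pullback_topology UNIV f T"
  have top: "topspace T = UNIV"
    and add: "continuous_map (prod_topology T T) T (\<lambda>(x, y). x + y)"
    and mul: "continuous_map (prod_topology euclidean T) T (\<lambda>(c, x). s2 c x)"
    and nb: "neighbourhood_base_at 0 (convex_wrt s2) T"
    using T by (auto simp: locally_convex_space_def)
  have vs: "vector_space s1" and f_add: "\<And>x y. f (x + y) = f x + f y"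
    and f_scale: "\<And>c x. f (s1 c x) = s2 c (f x)"
    using f by (auto simp: Vector_Spaces.linear_iff)
  have f0: "f 0 = 0" using f_add[of 0 0] by simp
  have topP: "topspace P = UNIV" by (simp add: P_def topspace_pullback_topology top)
  have cf: "continuous_map P T f"
    using continuous_map_pullback[OF continuous_map_id, of UNIV f T] by (simp add: P_def)
  have "continuous_map (prod_topology P P) (prod_topology T T) (\<lambda>(x, y). (f x, f y))"
    using cf by (simp add: continuous_map_prod_top)
  from continuous_map_compose[OF this add]
  have addP: "continuous_map (prod_topology P P) P (\<lambda>(x, y). x + y)"
    unfolding P_def
    by (intro continuous_map_pullback') (simp_all add: o_def case_prod_unfold f_add)
  have "continuous_map (prod_topology (euclidean :: 'k topology) P) (prod_topology euclidean T)
          (\<lambda>(c, x). (c, f x))"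
    using cf by (simp add: continuous_map_prod_top)
  from continuous_map_compose[OF this mul]
  have mulP: "continuous_map (prod_topology euclidean P) P (\<lambda>(c, x). s1 c x)"
    unfolding P_def
    by (intro continuous_map_pullback') (simp_all add: o_def case_prod_unfold f_scale)
  have nbP: "neighbourhood_base_at 0 (convex_wrt s1) P"
    unfolding neighbourhood_base_at_def
  proof (intro allI impI)
    fix W assume W: "openin P W \<and> 0 \<in> W"
    then obtain W' where W': "openin T W'" "W = f -` W'"
      by (auto simp: P_def openin_pullback_topology)
    with W f0 obtain U V where UV: "openin T U" "convex_wrt s2 V" "0 \<in> U" "U \<subseteq> V" "V \<subseteq> W'"
      using nb unfolding neighbourhood_base_at_def by (metis vimageD)
    have "openin P (f -` U)" using UV(1) by (auto simp: P_def openin_pullback_topology)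
    moreover have "convex_wrt s1 (f -` V)"
      using UV(2) by (simp add: convex_wrt_def f_add f_scale)
    ultimately show "\<exists>U V. openin P U \<and> convex_wrt s1 V \<and> 0 \<in> U \<and> U \<subseteq> V \<and> V \<subseteq> W"
      using UV W'(2) f0 by (intro exI[of _ "f -` U"] exI[of _ "f -` V"]) auto
  qed
  show ?thesis
    unfolding P_def[symmetric] locally_convex_space_def
    using vs topP addP mulP nbP by blast
qed

text \<open>
  The hypothesis says exactly that the pullback of \<open>T\<close> along \<open>f\<close> makes all inclusions of the
  \<open>X i\<close> continuous, so the finest such topology refines it.
\<close>

lemma continuous_map_from_inductive_limit:
  fixes smul :: "'k::{real_normed_field, banach} \<Rightarrow> 'a \<Rightarrow> 'a::ab_group_add"
    and smul' :: "'k \<Rightarrow> 'b \<Rightarrow> 'b::ab_group_add"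
  assumes f: "Vector_Spaces.linear smul smul' f" and T: "locally_convex_space smul' T"
    and restr: "\<And>i. i \<in> I \<Longrightarrow> continuous_map (norm_topology (X i) (nrm i)) T f"
  shows "continuous_map (inductive_limit_topology smul I X nrm) T f"
proof -
  let ?L = "inductive_limit_topology smul I X nrm"
  have vs: "vector_space smul" using f by (simp add: Vector_Spaces.linear_iff)
  have "continuous_map (norm_topology (X i) (nrm i)) (pullback_topology UNIV f T) (\<lambda>x. x)"
    if "i \<in> I" for i
    using restr[OF that] by (intro continuous_map_pullback') (simp_all add: o_def)
  then have "admissible_topology smul I X nrm (pullback_topology UNIV f T)"
    using locally_convex_space_pullback[OF f T] by (simp add: admissible_topology_def)
  then have "coarser_topology (pullback_topology UNIV f T) ?L"
    using inductive_limit_topology_finest[OF vs] by blast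
  then have "continuous_map ?L (pullback_topology UNIV f T) (\<lambda>x. x)"
    using topology_finer_continuous_id unfolding coarser_topology_def id_def by blast
  from continuous_map_compose[OF this continuous_map_pullback[OF continuous_map_id]]
  show ?thesis by (simp add: o_def)
qed

section \<open>Bounded maps on the normed spaces of the system\<close>

lemma Metric_space_norm_dist:
  fixes smul :: "'k::real_normed_field \<Rightarrow> 'a \<Rightarrow> 'a::ab_group_add"
  assumes vs: "vector_space smul" and sub: "module.subspace smul S" and n: "norm_on smul S n"
  shows "Metric_space S (norm_dist S n)"
proof -
  interpret vector_space smul by (rule vs)
  have diff: "x - y \<in> S" if "x \<in> S" "y \<in> S" for x y
    using sub that by (rule subspace_diff)
  have commute: "n (x - y) = n (y - x)" if "x \<in> S" "y \<in> S" for x y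
  proof -
    have "n (smul (- 1) (y - x)) = norm (- 1 :: 'k) * n (y - x)"
      using n diff[OF that(2,1)] unfolding norm_on_def by blast
    then show ?thesis by simp
  qed
  have triangle: "n (x - z) \<le> n (x - y) + n (y - z)" if "x \<in> S" "y \<in> S" "z \<in> S" for x y z
  proof -
    have "n (u + v) \<le> n u + n v" if "u \<in> S" "v \<in> S" for u v
      using n that by (simp add: norm_on_def)
    from this[OF diff diff, of x y y z] that show ?thesis by simp
  qed
  show ?thesis
  proof
    show "0 \<le> norm_dist S n x y" for x y
      using n diff by (simp add: norm_dist_def norm_on_def)
    show "norm_dist S n x y = norm_dist S n y x" for x y
      using commute by (simp add: norm_dist_def)
    show "norm_dist S n x y = 0 \<longleftrightarrow> x = y" if "x \<in> S" "y \<in> S" for x y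
      using n diff[OF that] that by (simp add: norm_dist_def norm_on_def)
    show "norm_dist S n x z \<le> norm_dist S n x y + norm_dist S n y z"
      if "x \<in> S" "y \<in> S" "z \<in> S" for x y z
      using triangle that by (simp add: norm_dist_def)
  qed
qed

lemma continuous_map_norm_topology_if_bounded:
  fixes smul :: "'k::real_normed_field \<Rightarrow> 'a \<Rightarrow> 'a::ab_group_add"
  assumes vs: "vector_space smul" and sub: "module.subspace smul S" and n: "norm_on smul S n"
    and diff: "\<And>x y. f (x - y) = f x - f y"
    and bound: "\<And>x. x \<in> S \<Longrightarrow> f x \<in> S \<and> n (f x) \<le> C * n x"
  shows "continuous_map (norm_topology S n) (norm_topology S n) f"
proof -
  note metric = Metric_space_norm_dist[OF vs sub n]
  interpret vector_space smul by (rule vs)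
  \<comment> \<open>\<open>C\<close> may be zero or negative, so \<open>\<bar>C\<bar> + 1\<close> serves as the Lipschitz constant.\<close>
  have "\<exists>\<delta>>0. \<forall>x. x \<in> S \<and> norm_dist S n a x < \<delta> \<longrightarrow> norm_dist S n (f a) (f x) < \<epsilon>"
    if "a \<in> S" "\<epsilon> > 0" for a \<epsilon>
  proof (intro exI conjI allI impI)
    show "\<epsilon> / (\<bar>C\<bar> + 1) > 0" using that by simp
    fix x assume x: "x \<in> S \<and> norm_dist S n a x < \<epsilon> / (\<bar>C\<bar> + 1)"
    have ax: "a - x \<in> S" using sub that x by (blast intro: subspace_diff)
    then have "0 \<le> n (a - x)" using n by (simp add: norm_on_def)
    then have "n (f (a - x)) \<le> (\<bar>C\<bar> + 1) * n (a - x)"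
      using bound[OF ax] mult_right_mono[of C "\<bar>C\<bar> + 1" "n (a - x)"] by linarith
    also have "\<dots> < \<epsilon>"
      using x that by (auto simp: norm_dist_def pos_less_divide_eq mult.commute)
    finally show "norm_dist S n (f a) (f x) < \<epsilon>"
      using x that bound by (simp add: norm_dist_def diff)
  qed
  then show ?thesis
    unfolding norm_topology_def Metric_space.metric_continuous_map[OF metric metric]
    using bound by blast
qed

section \<open>Cofinally bounded maps\<close>

context banach_inductive_system
begin

lemma continuous_map_inclusion:
  assumes "i \<in> I" "j \<in> I" "X i \<subseteq> X j"
  shows "continuous_map (norm_topology (X i) (nrm i)) (norm_topology (X j) (nrm j)) (\<lambda>x. x)"
proof -
  have "continuous_map (norm_topology (X i) (nrm i))
          (subtopology (norm_topology (X j) (nrm j)) (X i)) (\<lambda>x. x)"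
    using coarser[OF assms] topology_finer_continuous_id
    unfolding coarser_topology_def id_def by blast
  then show ?thesis by (simp add: continuous_map_in_subtopology)
qed

lemma inductive_limit_admissible:
  "admissible_topology smul I X nrm (inductive_limit_topology smul I X nrm)"
  using inductive_limit_topology_finest[OF vector_space_axioms] by blast

text \<open>
  Boundedness is needed only on arbitrarily large members of the system, since a smaller \<open>X i\<close>
  embeds continuously into a larger one.
\<close>

lemma continuous_map_inductive_limit_if_cofinally_bounded:
  assumes f: "Vector_Spaces.linear smul smul f"
    and bound: "\<And>i. i \<in> I \<Longrightarrow>
      \<exists>j\<in>I. X i \<subseteq> X j \<and> (\<exists>C. \<forall>x\<in>X j. f x \<in> X j \<and> nrm j (f x) \<le> C * nrm j x)"
  shows "continuous_map (inductive_limit_topology smul I X nrm)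
           (inductive_limit_topology smul I X nrm) f"
proof (rule continuous_map_from_inductive_limit[OF f])
  let ?L = "inductive_limit_topology smul I X nrm"
  show "locally_convex_space smul ?L"
    using inductive_limit_admissible by (simp add: admissible_topology_def)
  fix i assume i: "i \<in> I"
  with bound obtain j C where j: "j \<in> I" "X i \<subseteq> X j"
    and C: "\<And>x. x \<in> X j \<Longrightarrow> f x \<in> X j \<and> nrm j (f x) \<le> C * nrm j x" by meson
  have "module_hom smul smul f" using f by (simp add: module_hom_iff_linear)
  then have "f (x - y) = f x - f y" for x y by (rule module_hom.diff)
  then have "continuous_map (norm_topology (X j) (nrm j)) (norm_topology (X j) (nrm j)) f"
    using banach[OF j(1)] C vector_space_axioms unfolding banach_subspace_def
    by (blast intro: continuous_map_norm_topology_if_bounded)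
  moreover have "continuous_map (norm_topology (X j) (nrm j)) ?L (\<lambda>x. x)"
    using inductive_limit_admissible j(1) by (simp add: admissible_topology_def)
  ultimately have "continuous_map (norm_topology (X i) (nrm i)) ?L ((\<lambda>x. x) \<circ> (f \<circ> (\<lambda>x. x)))"
    using continuous_map_inclusion[OF i j] by (blast intro: continuous_map_compose)
  then show "continuous_map (norm_topology (X i) (nrm i)) ?L f" by (simp add: o_def)
qed

end

section \<open>Multiplication in a strong algebra\<close>

context strong_algebra
begin

lemma linear_mult_left: "Vector_Spaces.linear smul smul (\<lambda>x. a * x)"
  using vector_space_axioms
  by (simp add: Vector_Spaces.linear_iff distrib_left smul_mult_right)

lemma linear_mult_right: "Vector_Spaces.linear smul smul (\<lambda>x. x * a)"
  using vector_space_axioms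
  by (simp add: Vector_Spaces.linear_iff distrib_right smul_mult_left)

text \<open>
  With \<open>a \<in> X k\<close>, the strong inequality gives the constant \<open>C * nrm k a\<close> on every \<open>X j\<close> above
  \<open>X h\<close>; directedness supplies one that also contains \<open>X i\<close>.
\<close>

lemma mult_cofinally_bounded:
  assumes "i \<in> I"
  shows "\<exists>j\<in>I. X i \<subseteq> X j \<and> (\<exists>C. \<forall>x\<in>X j. a * x \<in> X j \<and> x * a \<in> X j \<and>
           nrm j (a * x) \<le> C * nrm j x \<and> nrm j (x * a) \<le> C * nrm j x)"
proof -
  obtain k where k: "k \<in> I" "a \<in> X k" using union by blast
  from strong[OF k(1)] obtain h where h: "h \<in> I" and
    h_bound: "\<forall>j\<in>I. X h \<subseteq> X j \<longrightarrow> (\<exists>C>0. \<forall>a\<in>X k. \<forall>b\<in>X j.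
         a * b \<in> X j \<and> b * a \<in> X j \<and>
         nrm j (a * b) \<le> C * nrm k a * nrm j b \<and> nrm j (b * a) \<le> C * nrm k a * nrm j b)"
    by blast
  from directed[OF assms h] obtain j where j: "j \<in> I" "X i \<subseteq> X j" "X h \<subseteq> X j" by blast
  with h_bound k(2) obtain C where "\<forall>x\<in>X j. a * x \<in> X j \<and> x * a \<in> X j \<and>
         nrm j (a * x) \<le> C * nrm k a * nrm j x \<and> nrm j (x * a) \<le> C * nrm k a * nrm j x"
    by meson
  with j show ?thesis by blast
qed

lemma continuous_mult_left:
  "continuous_map (inductive_limit_topology smul I X nrm)
     (inductive_limit_topology smul I X nrm) (\<lambda>x. a * x)"
  using mult_cofinally_bounded
  by (intro continuous_map_inductive_limit_if_cofinally_bounded linear_mult_left) meson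

lemma continuous_mult_right:
  "continuous_map (inductive_limit_topology smul I X nrm)
     (inductive_limit_topology smul I X nrm) (\<lambda>x. x * a)"
  using mult_cofinally_bounded
  by (intro continuous_map_inductive_limit_if_cofinally_bounded linear_mult_right) meson

end

theorem proposition3p2:
  fixes smul :: "'k::{real_normed_field, banach} \<Rightarrow> 'a \<Rightarrow> 'a::ring"
    and I :: "'i set" and X :: "'i \<Rightarrow> 'a set" and nrm :: "'i \<Rightarrow> 'a \<Rightarrow> real"
  assumes "strong_algebra smul I X nrm"
  shows "(\<forall>a. Vector_Spaces.linear smul smul (\<lambda>x. a * x) \<and>
              continuous_map (inductive_limit_topology smul I X nrm)
                (inductive_limit_topology smul I X nrm) (\<lambda>x. a * x) \<and>
              Vector_Spaces.linear smul smul (\<lambda>x. x * a) \<and>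
              continuous_map (inductive_limit_topology smul I X nrm)
                (inductive_limit_topology smul I X nrm) (\<lambda>x. x * a)) \<and>
         naimark_topological_algebra smul (inductive_limit_topology smul I X nrm)"
proof -
  interpret strong_algebra smul I X nrm by (rule assms)
  have "naimark_topological_algebra smul (inductive_limit_topology smul I X nrm)"
    unfolding naimark_topological_algebra_def
    using associative_algebra_axioms inductive_limit_admissible
      continuous_mult_left continuous_mult_right
    by (simp add: admissible_topology_def)
  then show ?thesis
    using linear_mult_left linear_mult_right continuous_mult_left continuous_mult_right by blast
qed

end
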